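(* Let $\Bbbk$ be a field and let $(A,\mu,\alpha,\beta)$ be a BiHom-associative algebra over $\Bbbk$, with $\mu(x\otimes y)=xy$. Let $\sigma,\gamma,\tau,\delta:A\to A$ be linear maps that are multiplicative with respect to $\mu$ and such that any two of the maps $\alpha,\beta,\sigma,\gamma,\tau,\delta$ commute. Let $N:A\to A$ be a linear map satisfying, for all $x,y\in A$ (juxtaposition of maps denotes composition): $$\alpha\sigma\gamma N=N\alpha\sigma\gamma,\qquad \beta\tau\delta N=N\beta\tau\delta,$$ $$\sigma\gamma N(x)\,\tau\delta N(y)=N\big(\sigma\gamma(x)\,\delta N(y)+\gamma N(x)\,\tau\delta(y)-N(\gamma(x)\delta(y))\big),$$ $$\alpha\sigma\gamma^2N(x)\,\tau\delta N(y)=N\big(\alpha\sigma\gamma^2(x)\,\delta N(y)+\alpha\gamma^2N(x)\,\tau\delta(y)-N(\alpha\gamma^2(x)\delta(y))\big),$$ $$\sigma\gamma N(x)\,\beta\tau\delta^2N(y)=N\big(\sigma\gamma(x)\,\beta\delta^2N(y)+\gamma N(x)\,\beta\tau\delta^2(y)-N(\gamma(x)\,\beta\delta^2(y))\big).$$ Define operations on $A$ by $$x\prec y=\sigma\gamma(x)\,\delta N(y),\qquad x\succ y=\gamma N(x)\,\tau\delta(y),\qquad x\vee y=-N(\gamma(x)\delta(y)),$$ for all $x,y\in A$. Then $(A,\prec,\succ,\vee,\alpha\sigma\gamma,\beta\tau\delta)$ is a BiHom-NS-algebra. In particular, if one defines a new multiplication on $A$ by $x\ast y=\sigma\gamma(x)\,\delta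 N(y)+\gamma N(x)\,\tau\delta(y)-N(\gamma(x)\delta(y))$, then $(A,\ast,\alpha\sigma\gamma,\beta\tau\delta)$ is a BiHom-associative algebra.
   Context: Everything is over a field $\Bbbk$; all maps are linear; algebras are not assumed associative or unital. A BiHom-associative algebra $(A,\mu,\alpha,\beta)$ is a linear space $A$ with linear maps $\mu:A\otimes A\to A$, $\mu(x\otimes y)=xy$, and $\alpha,\beta:A\to A$ such that $\alpha\circ\beta=\beta\circ\alpha$, $\alpha(xy)=\alpha(x)\alpha(y)$, $\beta(xy)=\beta(x)\beta(y)$ and $\alpha(x)(yz)=(xy)\beta(z)$ for all $x,y,z\in A$. A linear map $f:A\to A$ is multiplicative with respect to $\mu$ if $f(xy)=f(x)f(y)$ for all $x,y$. A BiHom-NS-algebra $(A,\prec,\succ,\vee,\alpha,\beta)$ is a linear space $A$ with linear maps $\prec,\succ,\vee:A\otimes A\to A$ and $\alpha,\beta:A\to A$ such that $\alpha\circ\beta=\beta\circ\alpha$, both $\alpha$ and $\beta$ are multiplicative with respect to each of $\prec,\succ,\vee$, and, writing $x\ast y=x\prec y+x\succ y+x\vee y$, for all $x,y,z\in A$: $(x\prec y)\prec\beta(z)=\alpha(x)\prec(y\ast z)$; $(x\succ y)\prec\beta(z)=\alpha(x)\succ(y\prec z)$; $(x\ast y)\succ\beta(z)=\alpha(x)\succ(y\succ z)$; $(x\vee y)\prec\beta(z)+(x\ast y)\vee\beta(z)=\alpha(x)\succ(y\vee z)+\alpha(x)\vee(y\ast z)$. *)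

theory Defs
  imports Complex_Main
begin

text \<open>
  The linear space is the whole type \<open>'v\<close> with scalar multiplication \<open>scale\<close> over the field
  \<open>'k\<close>. A linear map from the tensor square of the space to itself is given as the
  corresponding bilinear map.
\<close>

definition bilinear_op ::
  "('k::field \<Rightarrow> 'v::ab_group_add \<Rightarrow> 'v) \<Rightarrow> ('v \<Rightarrow> 'v \<Rightarrow> 'v) \<Rightarrow> bool"
  where "bilinear_op scale m \<longleftrightarrow>
    (\<forall>x. Vector_Spaces.linear scale scale (\<lambda>y. m x y)) \<and>
    (\<forall>y. Vector_Spaces.linear scale scale (\<lambda>x. m x y))"

definition multiplicative :: "('v \<Rightarrow> 'v \<Rightarrow> 'v) \<Rightarrow> ('v \<Rightarrow> 'v) \<Rightarrow> bool"
  where "multiplicative m f \<longleftrightarrow> (\<forall>x y. f (m x y) = m (f x) (f y))"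

locale bihom_associative_algebra = vector_space scale
  for scale :: "'k::field \<Rightarrow> 'v::ab_group_add \<Rightarrow> 'v" +
  fixes mult :: "'v \<Rightarrow> 'v \<Rightarrow> 'v" (infixl "\<cdot>" 70)
    and \<alpha> :: "'v \<Rightarrow> 'v"
    and \<beta> :: "'v \<Rightarrow> 'v"
  assumes bilinear_mult: "bilinear_op scale (\<cdot>)"
    and linear_\<alpha>: "Vector_Spaces.linear scale scale \<alpha>"
    and linear_\<beta>: "Vector_Spaces.linear scale scale \<beta>"
    and commute: "\<alpha> \<circ> \<beta> = \<beta> \<circ> \<alpha>"
    and mult_\<alpha>: "multiplicative (\<cdot>) \<alpha>"
    and mult_\<beta>: "multiplicative (\<cdot>) \<beta>"
    and bihom_assoc: "\<alpha> x \<cdot> (y \<cdot> z) = (x \<cdot> y) \<cdot> \<beta> z"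

definition ns_star ::
  "('v \<Rightarrow> 'v \<Rightarrow> 'v) \<Rightarrow> ('v \<Rightarrow> 'v \<Rightarrow> 'v) \<Rightarrow> ('v \<Rightarrow> 'v \<Rightarrow> 'v) \<Rightarrow> 'v \<Rightarrow> 'v \<Rightarrow> 'v::ab_group_add"
  where "ns_star prec succ vee x y = prec x y + succ x y + vee x y"

locale bihom_ns_algebra = vector_space scale
  for scale :: "'k::field \<Rightarrow> 'v::ab_group_add \<Rightarrow> 'v" +
  fixes prec :: "'v \<Rightarrow> 'v \<Rightarrow> 'v" (infixl "\<prec>" 70)
    and succ :: "'v \<Rightarrow> 'v \<Rightarrow> 'v" (infixl "\<succ>" 70)
    and vee :: "'v \<Rightarrow> 'v \<Rightarrow> 'v" (infixl "\<curlyvee>" 70)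
    and \<alpha> :: "'v \<Rightarrow> 'v"
    and \<beta> :: "'v \<Rightarrow> 'v"
  assumes bilinear_prec: "bilinear_op scale (\<prec>)"
    and bilinear_succ: "bilinear_op scale (\<succ>)"
    and bilinear_vee: "bilinear_op scale (\<curlyvee>)"
    and linear_\<alpha>: "Vector_Spaces.linear scale scale \<alpha>"
    and linear_\<beta>: "Vector_Spaces.linear scale scale \<beta>"
    and commute: "\<alpha> \<circ> \<beta> = \<beta> \<circ> \<alpha>"
    and prec_\<alpha>: "multiplicative (\<prec>) \<alpha>"
    and succ_\<alpha>: "multiplicative (\<succ>) \<alpha>"
    and vee_\<alpha>: "multiplicative (\<curlyvee>) \<alpha>"
    and prec_\<beta>: "multiplicative (\<prec>) \<beta>"
    and succ_\<beta>: "multiplicative (\<succ>) \<beta>"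
    and vee_\<beta>: "multiplicative (\<curlyvee>) \<beta>"
    and ns1: "(x \<prec> y) \<prec> \<beta> z = \<alpha> x \<prec> ns_star (\<prec>) (\<succ>) (\<curlyvee>) y z"
    and ns2: "(x \<succ> y) \<prec> \<beta> z = \<alpha> x \<succ> (y \<prec> z)"
    and ns3: "ns_star (\<prec>) (\<succ>) (\<curlyvee>) x y \<succ> \<beta> z = \<alpha> x \<succ> (y \<succ> z)"
    and ns4: "(x \<curlyvee> y) \<prec> \<beta> z + ns_star (\<prec>) (\<succ>) (\<curlyvee>) x y \<curlyvee> \<beta> z
        = \<alpha> x \<succ> (y \<curlyvee> z) + \<alpha> x \<curlyvee> ns_star (\<prec>) (\<succ>) (\<curlyvee>) y z"

end

theory Submission
  imports Defs
begin

text \<open>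
  Write \<open>a = \<alpha>\<sigma>\<gamma>\<close>, \<open>b = \<beta>\<tau>\<delta>\<close> and \<open>\<star>\<close> for the sum of the three operations. The first
  Rota-Baxter type identity says \<open>N (x \<star> y) = \<sigma>\<gamma>N x \<cdot> \<tau>\<delta>N y\<close>, which turns each of the first three
  NS axioms into a single instance of BiHom-associativity. In the fourth axiom, the identities
  involving \<open>\<beta>\<delta>\<close> and \<open>\<alpha>\<gamma>\<close> expand \<open>(x \<or> y) \<prec> b z\<close> and \<open>a x \<succ> (y \<or> z)\<close>
  respectively; on each side the terms with \<open>N\<close> of a product as a factor cancel, and the rest agrees
  by BiHom-associativity. Adding the four axioms yields BiHom-associativity of \<open>\<star>\<close>.
\<close>

lemma (in vector_space) bilinear_opI:
  assumes "\<And>x y z. m (x + y) z = m x z + m y z"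
    and "\<And>x y z. m x (y + z) = m x y + m x z"
    and "\<And>c x y. m (scale c x) y = scale c (m x y)"
    and "\<And>c x y. m x (scale c y) = scale c (m x y)"
  shows "bilinear_op scale m"
  unfolding bilinear_op_def Vector_Spaces.linear_iff
  using assms vector_space_axioms by auto

text \<open>Fixing either argument leaves an additive map, from which the sign and difference rules
  follow. They are wanted because \<open>\<or>\<close> is defined with a minus sign.\<close>

lemma bilinear_opD:
  assumes "bilinear_op scale m"
  shows "m (x + y) z = m x z + m y z" "m x (y + z) = m x y + m x z"
    and "m (scale c x) y = scale c (m x y)" "m x (scale c y) = scale c (m x y)"
    and "m (- x) y = - m x y" "m x (- y) = - m x y"
    and "m (x - y) z = m x z - m y z" "m x (y - z) = m x y - m x z"
proof -
  have l: "additive (\<lambda>x. m x y)" "additive (m x)" for x y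
    using assms by (auto simp: additive_def bilinear_op_def Vector_Spaces.linear_iff)
  show "m (scale c x) y = scale c (m x y)" "m x (scale c y) = scale c (m x y)"
    using assms by (auto simp: bilinear_op_def Vector_Spaces.linear_iff)
  show "m (x + y) z = m x z + m y z" "m x (y + z) = m x y + m x z"
    "m (- x) y = - m x y" "m x (- y) = - m x y"
    "m (x - y) z = m x z - m y z" "m x (y - z) = m x y - m x z"
    using additive.add[OF l(1)] additive.add[OF l(2)] additive.minus[OF l(1)]
      additive.minus[OF l(2)] additive.diff[OF l(1)] additive.diff[OF l(2)] by blast+
qed

lemmas linear_map_simps =
  module_hom.add[OF Vector_Spaces.module_hom_iff_linear[THEN iffD2]]
  module_hom.scale[OF Vector_Spaces.module_hom_iff_linear[THEN iffD2]]
  module_hom.neg[OF Vector_Spaces.module_hom_iff_linear[THEN iffD2]]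
  module_hom.diff[OF Vector_Spaces.module_hom_iff_linear[THEN iffD2]]

lemma (in bihom_ns_algebra) bihom_associative_ns_star:
  "bihom_associative_algebra scale (ns_star (\<prec>) (\<succ>) (\<curlyvee>)) \<alpha> \<beta>"
proof (intro bihom_associative_algebra.intro bihom_associative_algebra_axioms.intro)
  note bl = bilinear_opD[OF bilinear_prec] bilinear_opD[OF bilinear_succ]
    bilinear_opD[OF bilinear_vee]
  note mu = prec_\<alpha> succ_\<alpha> vee_\<alpha> prec_\<beta> succ_\<beta> vee_\<beta>
  let ?s = "ns_star (\<prec>) (\<succ>) (\<curlyvee>)"
  show "bilinear_op scale ?s"
    by (rule bilinear_opI) (simp_all add: ns_star_def bl algebra_simps)
  show "multiplicative ?s \<alpha>" "multiplicative ?s \<beta>"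
    using mu by (simp_all add: multiplicative_def ns_star_def linear_map_simps[OF linear_\<alpha>]
        linear_map_simps[OF linear_\<beta>])
  show "?s (\<alpha> x) (?s y z) = ?s (?s x y) (\<beta> z)" for x y z
  proof -
    \<comment> \<open>Only the outer \<open>\<prec>\<close> is distributed over the inner sum. Its
      \<open>\<curlyvee>\<close> summand joins the outer \<open>\<curlyvee>\<close>, so that the
      four groups are exactly the left sides of \<open>ns1\<close>, \<open>ns2\<close>,
      \<open>ns3\<close> and \<open>ns4\<close>.\<close>
    have "?s (?s x y) (\<beta> z) = (x \<prec> y) \<prec> \<beta> z + (x \<succ> y) \<prec> \<beta> z + ?s x y \<succ> \<beta> z
        + ((x \<curlyvee> y) \<prec> \<beta> z + ?s x y \<curlyvee> \<beta> z)"
      by (simp add: ns_star_def bl algebra_simps)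
    also have "\<dots> = \<alpha> x \<prec> ?s y z + \<alpha> x \<succ> (y \<prec> z) + \<alpha> x \<succ> (y \<succ> z)
        + (\<alpha> x \<succ> (y \<curlyvee> z) + \<alpha> x \<curlyvee> ?s y z)"
      by (simp only: ns1 ns2 ns3 ns4)
    also have "\<dots> = ?s (\<alpha> x) (?s y z)"
      by (simp add: ns_star_def bl algebra_simps)
    finally show ?thesis ..
  qed
qed (fact vector_space_axioms linear_\<alpha> linear_\<beta> commute)+

theorem theorem4p1:
  fixes scale :: "'k::field \<Rightarrow> 'v::ab_group_add \<Rightarrow> 'v"
    and mult :: "'v \<Rightarrow> 'v \<Rightarrow> 'v" (infixl "\<cdot>" 70)
    and \<alpha> \<beta> \<sigma> \<gamma> \<tau> \<delta> N :: "'v \<Rightarrow> 'v"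
  assumes "bihom_associative_algebra scale (\<cdot>) \<alpha> \<beta>"
    and "\<forall>f\<in>{\<sigma>, \<gamma>, \<tau>, \<delta>}. Vector_Spaces.linear scale scale f \<and> multiplicative (\<cdot>) f"
    and "\<forall>f\<in>{\<alpha>, \<beta>, \<sigma>, \<gamma>, \<tau>, \<delta>}. \<forall>g\<in>{\<alpha>, \<beta>, \<sigma>, \<gamma>, \<tau>, \<delta>}. f \<circ> g = g \<circ> f"
    and "Vector_Spaces.linear scale scale N"
    and "\<alpha> \<circ> \<sigma> \<circ> \<gamma> \<circ> N = N \<circ> \<alpha> \<circ> \<sigma> \<circ> \<gamma>"
    and "\<beta> \<circ> \<tau> \<circ> \<delta> \<circ> N = N \<circ> \<beta> \<circ> \<tau> \<circ> \<delta>"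
    and "\<forall>x y. \<sigma> (\<gamma> (N x)) \<cdot> \<tau> (\<delta> (N y))
      = N (\<sigma> (\<gamma> x) \<cdot> \<delta> (N y) + \<gamma> (N x) \<cdot> \<tau> (\<delta> y) - N (\<gamma> x \<cdot> \<delta> y))"
    and "\<forall>x y. \<alpha> (\<sigma> (\<gamma> (\<gamma> (N x)))) \<cdot> \<tau> (\<delta> (N y))
      = N (\<alpha> (\<sigma> (\<gamma> (\<gamma> x))) \<cdot> \<delta> (N y) + \<alpha> (\<gamma> (\<gamma> (N x))) \<cdot> \<tau> (\<delta> y)
           - N (\<alpha> (\<gamma> (\<gamma> x)) \<cdot> \<delta> y))"
    and "\<forall>x y. \<sigma> (\<gamma> (N x)) \<cdot> \<beta> (\<tau> (\<delta> (\<delta> (N y))))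
      = N (\<sigma> (\<gamma> x) \<cdot> \<beta> (\<delta> (\<delta> (N y))) + \<gamma> (N x) \<cdot> \<beta> (\<tau> (\<delta> (\<delta> y)))
           - N (\<gamma> x \<cdot> \<beta> (\<delta> (\<delta> y))))"
  shows "bihom_ns_algebra scale
      (\<lambda>x y. \<sigma> (\<gamma> x) \<cdot> \<delta> (N y))
      (\<lambda>x y. \<gamma> (N x) \<cdot> \<tau> (\<delta> y))
      (\<lambda>x y. - N (\<gamma> x \<cdot> \<delta> y))
      (\<alpha> \<circ> \<sigma> \<circ> \<gamma>) (\<beta> \<circ> \<tau> \<circ> \<delta>)
    \<and> bihom_associative_algebra scale
      (\<lambda>x y. \<sigma> (\<gamma> x) \<cdot> \<delta> (N y) + \<gamma> (N x) \<cdot> \<tau> (\<delta> y) - N (\<gamma> x \<cdot> \<delta> y))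
      (\<alpha> \<circ> \<sigma> \<circ> \<gamma>) (\<beta> \<circ> \<tau> \<circ> \<delta>)"
proof -
  interpret bihom_associative_algebra scale "(\<cdot>)" \<alpha> \<beta> by (fact assms(1))
  have lin: "Vector_Spaces.linear scale scale f" and mul: "multiplicative (\<cdot>) f"
    if "f \<in> {\<alpha>, \<beta>, \<sigma>, \<gamma>, \<tau>, \<delta>}" for f
    using that assms(2) linear_\<alpha> linear_\<beta> mult_\<alpha> mult_\<beta> by auto
  have mulD: "f (x \<cdot> y) = f x \<cdot> f y" if "f \<in> {\<alpha>, \<beta>, \<sigma>, \<gamma>, \<tau>, \<delta>}" for f x y
    using mul[OF that] by (simp add: multiplicative_def)
  have comD: "f (g x) = g (f x)"
    if "f \<in> {\<alpha>, \<beta>, \<sigma>, \<gamma>, \<tau>, \<delta>}" "g \<in> {\<alpha>, \<beta>, \<sigma>, \<gamma>, \<tau>, \<delta>}" for f g x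
    by (rule comp_eq_dest[OF bspec[OF bspec[OF assms(3) that(1)] that(2)]])
  note lins = linear_map_simps[OF lin[of \<alpha>], simplified] linear_map_simps[OF lin[of \<beta>], simplified]
    linear_map_simps[OF lin[of \<sigma>], simplified] linear_map_simps[OF lin[of \<gamma>], simplified]
    linear_map_simps[OF lin[of \<tau>], simplified] linear_map_simps[OF lin[of \<delta>], simplified]
    linear_map_simps[OF assms(4)] bilinear_opD[OF bilinear_mult]
  note muls = mulD[of \<alpha>, simplified] mulD[of \<beta>, simplified] mulD[of \<sigma>, simplified]
    mulD[of \<gamma>, simplified] mulD[of \<tau>, simplified] mulD[of \<delta>, simplified]
  \<comment> \<open>One orientation for each of the 15 pairs: as rewrite rules these sort every
    chain of maps into the order \<alpha>, \<beta>, \<sigma>, \<gamma>, \<tau>, \<delta> from the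
    outside in.\<close>
  note coms = comD[of \<beta> \<alpha>, simplified] comD[of \<sigma> \<alpha>, simplified] comD[of \<gamma> \<alpha>, simplified]
    comD[of \<tau> \<alpha>, simplified] comD[of \<delta> \<alpha>, simplified] comD[of \<sigma> \<beta>, simplified]
    comD[of \<gamma> \<beta>, simplified] comD[of \<tau> \<beta>, simplified] comD[of \<delta> \<beta>, simplified]
    comD[of \<gamma> \<sigma>, simplified] comD[of \<tau> \<sigma>, simplified] comD[of \<delta> \<sigma>, simplified]
    comD[of \<tau> \<gamma>, simplified] comD[of \<delta> \<gamma>, simplified] comD[of \<delta> \<tau>, simplified]
  \<comment> \<open>\<open>N\<close> commutes only with the two whole composites. The left sides of
    \<open>Na\<close> and \<open>Nb\<close> are in the sorted order, and \<open>N\<close> moves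
    inwards.\<close>
  have Na: "N (\<alpha> (\<sigma> (\<gamma> x))) = \<alpha> (\<sigma> (\<gamma> (N x)))" for x
    using fun_cong[OF assms(5), of x] by simp
  have Nb: "N (\<beta> (\<tau> (\<delta> x))) = \<beta> (\<tau> (\<delta> (N x)))" for x
    using fun_cong[OF assms(6), of x] by simp
  let ?p = "\<lambda>x y. \<sigma> (\<gamma> x) \<cdot> \<delta> (N y)"
  let ?s = "\<lambda>x y. \<gamma> (N x) \<cdot> \<tau> (\<delta> y)"
  let ?v = "\<lambda>x y. - N (\<gamma> x \<cdot> \<delta> y)"
  let ?a = "\<alpha> \<circ> \<sigma> \<circ> \<gamma>" and ?b = "\<beta> \<circ> \<tau> \<circ> \<delta>"
  have N_star: "N (ns_star ?p ?s ?v x y) = \<sigma> (\<gamma> (N x)) \<cdot> \<tau> (\<delta> (N y))" for x y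
    using assms(7) by (simp add: ns_star_def)
  have "bihom_ns_algebra scale ?p ?s ?v ?a ?b"
  proof (intro bihom_ns_algebra.intro bihom_ns_algebra_axioms.intro)
    show "bilinear_op scale ?p" "bilinear_op scale ?s" "bilinear_op scale ?v"
      by (rule bilinear_opI; simp add: lins)+
    show "Vector_Spaces.linear scale scale ?a" "Vector_Spaces.linear scale scale ?b"
      using vector_space_axioms by (simp_all add: Vector_Spaces.linear_iff lins)
    show "?a \<circ> ?b = ?b \<circ> ?a"
      by (simp add: fun_eq_iff coms)
    show "multiplicative ?p ?a" "multiplicative ?s ?a" "multiplicative ?p ?b" "multiplicative ?s ?b"
      by (simp_all add: multiplicative_def Na Nb muls coms)
    \<comment> \<open>Here \<open>N\<close> stands outside a product, so the rule is reversed: once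
      \<open>N\<close> is pulled out, the composite acts on the product itself and splits over
      it.\<close>
    show "multiplicative ?v ?a"
      by (simp add: multiplicative_def lins muls coms flip: Na)
    show "multiplicative ?v ?b"
      by (simp add: multiplicative_def lins muls coms flip: Nb)
    fix x y z
    \<comment> \<open>Both sides reduce to associativity for
      \<open>\<sigma> (\<sigma> (\<gamma> (\<gamma> x)))\<close>,
      \<open>\<sigma> (\<gamma> (\<delta> (N y)))\<close> and
      \<open>\<tau> (\<delta> (\<delta> (N z)))\<close>; the outer \<alpha> and \<beta> come from
      \<open>?a\<close> and \<open>?b\<close>. The next two axioms work alike.\<close>
    show "?p (?p x y) (?b z) = ?p (?a x) (ns_star ?p ?s ?v y z)"
      by (simp add: N_star Nb muls coms bihom_assoc)
    show "?p (?s x y) (?b z) = ?s (?a x) (?p y z)"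
      by (simp add: Na Nb muls coms bihom_assoc)
    show "?s (ns_star ?p ?s ?v x y) (?b z) = ?s (?a x) (?s y z)"
      by (simp add: N_star Na muls coms bihom_assoc)
    define u where "u = \<gamma> x \<cdot> \<delta> y"
    define v where "v = \<gamma> y \<cdot> \<delta> z"
    \<comment> \<open>Moving \<open>N\<close> past \<open>?b\<close> leaves a second \<delta> beside
      the one in \<open>?p\<close>, which is the shape of the identity with \<beta> and the square
      of \<delta>, taken at \<open>u\<close> and \<open>z\<close>.\<close>
    have "?p (?v x y) (?b z) = - (\<sigma> (\<gamma> (N u)) \<cdot> \<beta> (\<tau> (\<delta> (\<delta> (N z)))))"
      by (simp add: u_def Nb lins coms)
    also have "\<dots> = - N (\<sigma> (\<gamma> u) \<cdot> \<beta> (\<delta> (\<delta> (N z))) + \<gamma> (N u) \<cdot> \<beta> (\<tau> (\<delta> (\<delta> z)))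
           - N (\<gamma> u \<cdot> \<beta> (\<delta> (\<delta> z))))"
      using assms(9) by simp
    finally have 1: "?p (?v x y) (?b z) = \<dots>" .
    have "?s (?a x) (?v y z) = - (\<alpha> (\<sigma> (\<gamma> (\<gamma> (N x)))) \<cdot> \<tau> (\<delta> (N v)))"
      by (simp add: v_def Na lins coms)
    also have "\<dots> = - N (\<alpha> (\<sigma> (\<gamma> (\<gamma> x))) \<cdot> \<delta> (N v) + \<alpha> (\<gamma> (\<gamma> (N x))) \<cdot> \<tau> (\<delta> v)
           - N (\<alpha> (\<gamma> (\<gamma> x)) \<cdot> \<delta> v))"
      using assms(8) by simp
    finally have 2: "?s (?a x) (?v y z) = \<dots>" .
    show "?p (?v x y) (?b z) + ?v (ns_star ?p ?s ?v x y) (?b z)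
        = ?s (?a x) (?v y z) + ?v (?a x) (ns_star ?p ?s ?v y z)"
      \<comment> \<open>The terms \<open>N (\<gamma> (N u) \<cdot> \<beta> (\<tau> (\<delta>
        (\<delta> z))))\<close> on the left and \<open>N (\<alpha> (\<sigma> (\<gamma> (\<gamma>
        x))) \<cdot> \<delta> (N v))\<close> on the right cancel. The four terms left on each side,
        one of them under a double \<open>N\<close>, match in pairs by
        \<open>bihom_assoc\<close>.\<close>
      unfolding 1 2 by (simp add: ns_star_def u_def v_def lins muls coms bihom_assoc)
  qed (fact vector_space_axioms)
  with bihom_ns_algebra.bihom_associative_ns_star[OF this] show ?thesis
    by (simp add: ns_star_def[abs_def])
qed

end
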